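(* Let $\mathbb{V}$ be a vector space over a field $\mathbb{F}$ of $q$ elements with basis $\{\alpha_1,\alpha_2,\ldots,\alpha_n\}$, $n\ge 1$, let $\Gamma(\mathbb{V})$ be its non-zero component graph, and let $\dim_{\Gamma(\mathbb{V})}$ denote the metric dimension of $\Gamma(\mathbb{V})$. Then: a) if $q=2$ and $n=2$, then $\dim_{\Gamma(\mathbb{V})}=1$; b) if $q=2$ and $n\geq 3$, then $\dim_{\Gamma(\mathbb{V})}=n$; and c) if $q\geq 3$, then $\dim_{\Gamma(\mathbb{V})}=\sum_{k=1}^n\binom{n}{k}\left((q-1)^k-1\right)$.
   Context: The non-zero component graph $\Gamma(\mathbb{V})$ with respect to the basis $\{\alpha_1,\ldots,\alpha_n\}$ is the simple graph whose vertices are the non-zero vectors of $\mathbb{V}$; two distinct vertices are joined by an edge if there is at least one $\alpha_i$ having non-zero coefficient in the basis expansions of both of them. In a finite simple connected graph $\Gamma$, $d(u,v)$ is the length of a shortest path between $u$ and $v$. A set $W=\{w_1,\ldots,w_k\}$ of vertices is a resolving set if distinct vertices $v$ of $\Gamma$ have distinct representations $r(v|W)=(d(v,w_1),\ldots,d(v,w_k))$. The metric dimension of $\Gamma$ is the minimum cardinality of a resolving set of $\Gamma$. *)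

theory Defs
  imports "Graph_Theory.Graph_Theory" "HOL.Vector_Spaces"
begin

text \<open>Simple graphs are the symmetric loop-free digraphs of the library (locale
  \<^locale>\<open>pair_graph\<close>): an edge joining \<open>u\<close> and \<open>v\<close> is the pair of arcs \<open>(u, v)\<close>, \<open>(v, u)\<close>.\<close>

text \<open>Not meaningful if there is no path from \<open>u\<close> to \<open>v\<close>.\<close>
definition graph_dist :: "('a, 'b) pre_digraph \<Rightarrow> 'a \<Rightarrow> 'a \<Rightarrow> nat" where
  "graph_dist G u v = (LEAST k. \<exists>p. pre_digraph.apath G u p v \<and> length p = k)"

text \<open>The tuple of distances to the elements of \<open>W\<close> is indexed by \<open>W\<close> itself rather than by an
  enumeration of \<open>W\<close>.\<close>
definition metric_representation :: "('a, 'b) pre_digraph \<Rightarrow> 'a set \<Rightarrow> 'a \<Rightarrow> 'a \<Rightarrow> nat" where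
  "metric_representation G W v = restrict (\<lambda>w. graph_dist G v w) W"

definition resolving_set :: "('a, 'b) pre_digraph \<Rightarrow> 'a set \<Rightarrow> bool" where
  "resolving_set G W \<longleftrightarrow>
     finite W \<and> W \<subseteq> verts G \<and> inj_on (metric_representation G W) (verts G)"

definition metric_dimension :: "('a, 'b) pre_digraph \<Rightarrow> nat" where
  "metric_dimension G = (LEAST k. \<exists>W. resolving_set G W \<and> card W = k)"

lemma (in fin_digraph) graph_dist_eq_\<mu>:
  assumes "u \<rightarrow>\<^sup>* v"
  shows "ereal (real (graph_dist G u v)) = \<mu> (\<lambda>_. 1) u v"
proof -
  have cost: "awalk_cost (\<lambda>_. 1) p = real (length p)" for p :: "'b awalk"
    by (induct p) auto
  obtain p where p: "apath u p v" "\<mu> (\<lambda>_. 1) u v = awalk_cost (\<lambda>_. 1) p"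
    using min_cost_awalk[OF assms, of "\<lambda>_. 1"] by auto
  have "graph_dist G u v = length p"
    unfolding graph_dist_def
  proof (rule Least_equality)
    show "length p \<le> k" if k: "\<exists>p. apath u p v \<and> length p = k" for k
    proof -
      obtain p' where p': "apath u p' v" "length p' = k" using k by blast
      have "\<mu> (\<lambda>_. 1) u v \<le> awalk_cost (\<lambda>_. 1) p'"
        by (rule min_cost_le_walk_cost) (use p' in \<open>simp add: apath_def\<close>)
      then show ?thesis using p p' by (simp add: cost)
    qed
  qed (use p in blast)
  then show ?thesis using p by (simp add: cost)
qed

context vector_space
begin

definition nonzero_component_graph :: "'b set \<Rightarrow> 'b pair_pre_digraph" where
  "nonzero_component_graph B =
     \<lparr> pverts = {v. v \<noteq> 0},
       parcs = {(u, v). u \<noteq> 0 \<and> v \<noteq> 0 \<and> u \<noteq> v \<and>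
         (\<exists>b\<in>B. representation B u b \<noteq> 0 \<and> representation B v b \<noteq> 0)} \<rparr>"

end

lemma (in finite_dimensional_vector_space) finite_vectors:
  assumes "finite (UNIV :: 'a set)"
  shows "finite (UNIV :: 'b set)"
proof -
  have "(UNIV :: 'b set) \<subseteq> (\<lambda>f. \<Sum>b\<in>Basis. scale (f b) b) ` (Basis \<rightarrow>\<^sub>E UNIV)"
  proof
    fix v :: 'b
    have "(\<Sum>b\<in>Basis. scale (restrict (representation Basis v) Basis b) b) = v"
      using sum_representation_eq[OF independent_Basis _ finite_Basis order_refl, of v]
      by (simp add: span_Basis)
    then show "v \<in> (\<lambda>f. \<Sum>b\<in>Basis. scale (f b) b) ` (Basis \<rightarrow>\<^sub>E UNIV)"
      by (intro image_eqI[where x = "restrict (representation Basis v) Basis"]) auto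
  qed
  then show ?thesis
    by (rule finite_subset) (auto intro!: finite_PiE finite_Basis assms)
qed

lemma (in finite_dimensional_vector_space) pair_graph_nonzero_component_graph:
  assumes "finite (UNIV :: 'a set)"
  shows "pair_graph (nonzero_component_graph Basis)"
proof -
  have fin: "finite (A :: 'b set)" for A
    using finite_vectors[OF assms] by (rule rev_finite_subset) simp
  have fin2: "finite (R :: ('b \<times> 'b) set)" for R
    by (rule finite_subset[OF _ finite_cartesian_product[OF fin[of UNIV] fin[of UNIV]]]) simp
  show ?thesis
    by unfold_locales
      (auto simp: nonzero_component_graph_def fin fin2 arcs_ends_def symmetric_def arc_to_ends_def
        with_proj_def intro!: symI)
qed

lemma (in finite_dimensional_vector_space) connected_nonzero_component_graph:
  assumes "u \<noteq> 0" "v \<noteq> 0"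
  shows "u \<rightarrow>\<^sup>*\<^bsub>with_proj (nonzero_component_graph Basis)\<^esub> v"
proof -
  let ?G = "nonzero_component_graph Basis"
  let ?w = "\<Sum>b\<in>Basis. b"
  interpret pair_wf_digraph ?G
    by unfold_locales (auto simp: nonzero_component_graph_def)
  have coord: "\<exists>b\<in>Basis. representation Basis x b \<noteq> 0" if "x \<noteq> 0" for x
  proof (rule ccontr)
    assume "\<not> ?thesis"
    then have "(\<Sum>b\<in>Basis. scale (representation Basis x b) b) = 0" by simp
    then show False
      using that sum_representation_eq[OF independent_Basis _ finite_Basis order_refl, of x]
      by (simp add: span_Basis)
  qed
  have one: "representation Basis ?w b = 1" if "b \<in> Basis" for b
  proof -
    have "representation Basis ?w b = (\<Sum>c\<in>Basis. representation Basis c b)"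
      by (subst representation_sum) (auto simp: independent_Basis span_Basis)
    also have "\<dots> = (\<Sum>c\<in>Basis. if b = c then 1 else 0)"
      by (rule sum.cong) (auto simp: representation_basis[OF independent_Basis])
    finally show ?thesis using that finite_Basis by simp
  qed
  have w: "?w \<noteq> 0"
  proof
    assume "?w = 0"
    then have "representation Basis ?w b = 0" for b by (simp add: representation_zero)
    moreover obtain b where "b \<in> Basis" using coord assms by blast
    ultimately show False using one by fastforce
  qed
  have edge: "x \<rightarrow>\<^sup>*\<^bsub>with_proj ?G\<^esub> ?w \<and> ?w \<rightarrow>\<^sup>*\<^bsub>with_proj ?G\<^esub> x" if "x \<noteq> 0" for x
  proof (cases "x = ?w")
    case True
    have "x \<in> pverts ?G" using that by (simp add: nonzero_component_graph_def)
    then show ?thesis unfolding True[symmetric] by simp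
  next
    case False
    obtain b where "b \<in> Basis" "representation Basis x b \<noteq> 0" using coord \<open>x \<noteq> 0\<close> by blast
    then have "(x, ?w) \<in> parcs ?G" "(?w, x) \<in> parcs ?G"
      using False \<open>x \<noteq> 0\<close> w one by (fastforce simp: nonzero_component_graph_def)+
    then show ?thesis by (auto intro!: reachable_adjI)
  qed
  show ?thesis using edge assms reachable_trans by blast
qed

end

theory Submission
  imports Defs
begin

text \<open>The distance between distinct non-zero vectors is 1 or 2 according to whether their supports
  meet, so vectors with equal support are twins and a resolving set contains all but at most one
  vector of each support. For \<open>q \<ge> 3\<close> such a choice still meets every singleton support,
  and the vectors with singleton support read off the support of any other vector. For \<open>q = 2\<close>
  vectors are determined by their supports: the basis resolves, and counting representations
  gives \<open>2 ^ n - 1 \<le> k + 2 ^ k\<close> for a resolving set of size \<open>k\<close>.\<close>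

section \<open>Resolving sets of arbitrary graphs, distances up to 2, and a count of subsets\<close>

lemma metric_dimension_eqI:
  assumes "resolving_set G W"
    and "\<And>W'. resolving_set G W' \<Longrightarrow> card W \<le> card W'"
  shows "metric_dimension G = card W"
  unfolding metric_dimension_def using assms by (intro Least_equality) auto

lemma resolving_setD:
  assumes "resolving_set G W" "u \<in> verts G" "v \<in> verts G"
    and "\<And>w. w \<in> W \<Longrightarrow> graph_dist G u w = graph_dist G v w"
  shows "u = v"
proof -
  have "metric_representation G W u = metric_representation G W v"
    unfolding metric_representation_def by (rule restrict_ext) (rule assms(4))
  then show ?thesis using assms by (auto simp: resolving_set_def inj_on_def)
qed

lemma resolving_setI:
  assumes "finite W" "W \<subseteq> verts G"
    and "\<And>u v. u \<in> verts G \<Longrightarrow> v \<in> verts G \<Longrightarrow>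
      (\<And>w. w \<in> W \<Longrightarrow> graph_dist G u w = graph_dist G v w) \<Longrightarrow> u = v"
  shows "resolving_set G W"
  unfolding resolving_set_def
proof (intro conjI inj_onI)
  fix u v
  assume uv: "u \<in> verts G" "v \<in> verts G"
    and eq: "metric_representation G W u = metric_representation G W v"
  show "u = v"
  proof (rule assms(3)[OF uv])
    show "graph_dist G u w = graph_dist G v w" if "w \<in> W" for w
      using fun_cong[OF eq, of w] that by (simp add: metric_representation_def)
  qed
qed (use assms in auto)

text \<open>Vertices outside \<open>W\<close> have pairwise distinct representations, which are
  functions from \<open>W\<close> to \<open>D\<close>. The vertices of \<open>W\<close> are counted
  separately, so \<open>D\<close> can leave out the distance 0.\<close>

lemma card_verts_le_of_resolving_set:
  assumes W: "resolving_set G W" and "finite D"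
    and D: "\<And>u w. u \<in> verts G - W \<Longrightarrow> w \<in> W \<Longrightarrow> graph_dist G u w \<in> D"
  shows "card (verts G) \<le> card W + card D ^ card W"
proof -
  have fin: "finite W" and sub: "W \<subseteq> verts G"
    and inj: "inj_on (metric_representation G W) (verts G)"
    using W by (auto simp: resolving_set_def)
  have "metric_representation G W ` (verts G - W) \<subseteq> W \<rightarrow>\<^sub>E D"
    using D by (auto simp: metric_representation_def)
  then have "card (verts G - W) \<le> card (W \<rightarrow>\<^sub>E D)"
    using fin \<open>finite D\<close> inj
    by (intro card_inj_on_le[of "metric_representation G W"] finite_PiE)
      (auto intro: inj_on_subset)
  then have "card (verts G - W) \<le> card D ^ card W"
    by (simp add: card_PiE fin)
  then show ?thesis
    using card_Diff_subset[OF fin sub] by linarith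
qed

text \<open>Two members of \<open>C\<close> that both lie outside \<open>W\<close> would be equally
  far from every element of \<open>W\<close>, so \<open>W\<close> misses at most one member of
  \<open>C\<close>.\<close>

lemma card_twins_le_of_resolving_set:
  assumes W: "resolving_set G W" and "finite C" "C \<subseteq> verts G"
    and twins: "\<And>u v w. u \<in> C \<Longrightarrow> v \<in> C \<Longrightarrow> w \<in> verts G \<Longrightarrow> w \<noteq> u \<Longrightarrow> w \<noteq> v \<Longrightarrow>
      graph_dist G u w = graph_dist G v w"
  shows "card C - 1 \<le> card (W \<inter> C)"
proof -
  have fin: "finite W" and sub: "W \<subseteq> verts G" using W by (auto simp: resolving_set_def)
  have "u = v" if "u \<in> C - W" "v \<in> C - W" for u v
    by (rule resolving_setD[OF W]) (use that assms(3) sub in \<open>auto intro!: twins\<close>)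
  then have "card (C - W) \<le> 1"
    using \<open>finite C\<close> by (simp add: card_le_Suc0_iff_eq)
  moreover have "card C = card (W \<inter> C) + card (C - W)"
    using \<open>finite C\<close> by (subst card_Un_disjoint[symmetric]) (auto intro: arg_cong[where f = card] simp: fin)
  ultimately show ?thesis by linarith
qed

text \<open>The vertex \<open>x\<close> serves as a common neighbour whenever \<open>u\<close> and
  \<open>v\<close> are distinct and not adjacent. Since there are no loops, \<open>x\<close> then
  differs from both, so the walk through \<open>x\<close> is a path.\<close>

lemma graph_dist_pair_digraph:
  fixes G :: "'v pair_pre_digraph"
  assumes "pair_wf_digraph G" "u \<in> pverts G" "v \<in> pverts G"
    and "x \<in> pverts G" "u \<noteq> v \<Longrightarrow> (u, v) \<notin> parcs G \<Longrightarrow> (u, x) \<in> parcs G \<and> (x, v) \<in> parcs G"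
    and "\<And>y. (y, y) \<notin> parcs G"
  shows "graph_dist (with_proj G) u v =
    (if u = v then 0 else if (u, v) \<in> parcs G then 1 else 2)"
proof -
  interpret pair_wf_digraph G by fact
  have len0: "apath u p v \<and> length p = 0 \<longleftrightarrow> p = [] \<and> u = v" for p
    using assms by (auto simp: apath_def awalk_def)
  have len1: "(u, v) \<in> parcs G" if "apath u p v" "length p = 1" for p
    using that by (auto simp: length_Suc_conv apath_def awalk_Cons_iff awalk_Nil_iff)
  show ?thesis
  proof (cases "u = v")
    case True
    then show ?thesis
      unfolding graph_dist_def using len0 by (auto intro!: Least_equality)
  next
    case False
    have "graph_dist (with_proj G) u v = 1" if "(u, v) \<in> parcs G"
      unfolding graph_dist_def
    proof (rule Least_equality)
      show "\<exists>p. apath u p v \<and> length p = 1"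
        using that assms False
        by (intro exI[of _ "[(u, v)]"]) (auto simp: apath_def awalk_Cons_iff awalk_Nil_iff)
      show "1 \<le> k" if "\<exists>p. apath u p v \<and> length p = k" for k
        using that len0 False by (cases k) auto
    qed
    moreover have "graph_dist (with_proj G) u v = 2" if uv: "(u, v) \<notin> parcs G"
      unfolding graph_dist_def
    proof (rule Least_equality)
      have "x \<noteq> u" "x \<noteq> v" using assms False uv by auto
      then show "\<exists>p. apath u p v \<and> length p = 2"
        using uv assms False
        by (intro exI[of _ "[(u, x), (x, v)]"]) (auto simp: apath_def awalk_Cons_iff awalk_Nil_iff)
      show "2 \<le> k" if "\<exists>p. apath u p v \<and> length p = k" for k
      proof -
        have "k \<noteq> 0" "k \<noteq> 1" using that len0 len1 False uv by auto
        then show ?thesis by linarith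
      qed
    qed
    ultimately show ?thesis using False by simp
  qed
qed

text \<open>Grouping the subsets by size turns a sum over supports into the binomial sum of the case
  of at least three scalars.\<close>

lemma sum_card_nonempty_subsets:
  fixes f :: "nat \<Rightarrow> nat"
  assumes "finite A"
  shows "(\<Sum>S\<in>Pow A - {{}}. f (card S)) = (\<Sum>k=1..card A. (card A choose k) * f k)"
proof -
  have "(\<Sum>S\<in>Pow A - {{}}. f (card S)) =
    (\<Sum>k=1..card A. \<Sum>S\<in>{S \<in> Pow A - {{}}. card S = k}. f (card S))"
  proof (rule sum.group[symmetric])
    show "card ` (Pow A - {{}}) \<subseteq> {1..card A}"
      using assms by (auto simp: Suc_le_eq card_gt_0_iff card_mono dest: finite_subset)
  qed (use assms in auto)
  also have "\<dots> = (\<Sum>k=1..card A. (card A choose k) * f k)"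
  proof (rule sum.cong[OF refl])
    fix k assume k: "k \<in> {1..card A}"
    then have "{S \<in> Pow A - {{}}. card S = k} = {S. S \<subseteq> A \<and> card S = k}" by auto
    then show "(\<Sum>S\<in>{S \<in> Pow A - {{}}. card S = k}. f (card S)) = (card A choose k) * f k"
      by (simp add: n_subsets[OF assms])
  qed
  finally show ?thesis .
qed

section \<open>Supports of vectors and the number of vectors with a given support\<close>

context finite_dimensional_vector_space
begin

definition supp :: "'b \<Rightarrow> 'b set" where
  "supp v = {b \<in> Basis. representation Basis v b \<noteq> 0}"

abbreviation component_graph :: "('b, 'b \<times> 'b) pre_digraph" where
  "component_graph \<equiv> with_proj (nonzero_component_graph Basis)"

lemma supp_subset: "supp v \<subseteq> Basis"
  by (auto simp: supp_def)

lemma representation_inject: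
  assumes "\<And>b. b \<in> Basis \<Longrightarrow> representation Basis u b = representation Basis v b"
  shows "u = v"
proof -
  have "(\<Sum>b\<in>Basis. scale (representation Basis w b) b) = w" for w
    using sum_representation_eq[OF independent_Basis _ finite_Basis order_refl, of w]
    by (simp add: span_Basis)
  then show ?thesis using assms by (metis (no_types, lifting) sum.cong)
qed

lemma supp_eq_empty_iff [simp]: "supp v = {} \<longleftrightarrow> v = 0"
proof
  show "supp v = {} \<Longrightarrow> v = 0"
    by (rule representation_inject) (auto simp: supp_def representation_zero)
qed (simp add: supp_def representation_zero)

lemma supp_zero [simp]: "supp 0 = {}"
  by simp

lemma supp_basis: "b \<in> Basis \<Longrightarrow> supp b = {b}"
  by (auto simp: supp_def representation_basis[OF independent_Basis])

lemma bij_betw_vectors_with_supp: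
  assumes "S \<subseteq> Basis"
  shows "bij_betw (\<lambda>v. restrict (representation Basis v) S) {v. supp v = S} (S \<rightarrow>\<^sub>E - {0})"
  unfolding bij_betw_def
proof
  show "inj_on (\<lambda>v. restrict (representation Basis v) S) {v. supp v = S}"
  proof (intro inj_onI representation_inject)
    fix u v b
    assume u: "u \<in> {v. supp v = S}" and v: "v \<in> {v. supp v = S}" and b: "b \<in> Basis"
      and eq: "restrict (representation Basis u) S = restrict (representation Basis v) S"
    show "representation Basis u b = representation Basis v b"
    proof (cases "b \<in> S")
      case True
      then show ?thesis using fun_cong[OF eq, of b] by simp
    next
      case False
      then have "b \<notin> supp u" "b \<notin> supp v" using u v by auto
      then show ?thesis using b by (simp add: supp_def)
    qed
  qed
  show "(\<lambda>v. restrict (representation Basis v) S) ` {v. supp v = S} = S \<rightarrow>\<^sub>E - {0}"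
  proof
    show "S \<rightarrow>\<^sub>E - {0} \<subseteq> (\<lambda>v. restrict (representation Basis v) S) ` {v. supp v = S}"
    proof
      fix f :: "'b \<Rightarrow> 'a" assume f: "f \<in> S \<rightarrow>\<^sub>E - {0}"
      \<comment> \<open>Extending \<open>f\<close> by 0 gives a total coefficient function with
        finite support, the form that \<open>representation_eqI\<close> expects.\<close>
      define g where "g b = (if b \<in> S then f b else 0)" for b
      have S: "{b. g b \<noteq> 0} = S" using f by (auto simp: g_def PiE_iff)
      define v where "v = (\<Sum>b | g b \<noteq> 0. scale (g b) b)"
      have rep: "representation Basis v = g"
      proof (rule representation_eqI)
        show "b \<in> Basis" if "g b \<noteq> 0" for b using that S assms by blast
        show "finite {b. g b \<noteq> 0}" using S assms finite_Basis finite_subset by metis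
      qed (auto simp: independent_Basis span_Basis v_def)
      have "supp v = S" using S assms by (auto simp: supp_def rep)
      moreover have "f = restrict (representation Basis v) S"
        using f by (auto simp: rep g_def PiE_iff extensional_def fun_eq_iff)
      ultimately show "f \<in> (\<lambda>v. restrict (representation Basis v) S) ` {v. supp v = S}" by blast
    qed
  qed (auto simp: supp_def)
qed

lemma card_vectors_with_supp:
  assumes "S \<subseteq> Basis"
  shows "card {v. supp v = S} = (card (UNIV :: 'a set) - 1) ^ card S"
proof -
  have "finite S" using assms finite_Basis finite_subset by blast
  then show ?thesis
    using bij_betw_same_card[OF bij_betw_vectors_with_supp[OF assms]]
    \<comment> \<open>Over an infinite field \<open>card\<close> is 0 both for all scalars and for
      the non-zero ones, so both sides are the same power of 0.\<close>
    by (cases "finite (UNIV :: 'a set)") (simp_all add: card_PiE Compl_eq_Diff_UNIV card_Diff_singleton)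
qed

section \<open>Distances in the component graph\<close>

lemma pverts_nonzero_component_graph [simp]:
  "pverts (nonzero_component_graph Basis) = {v. v \<noteq> 0}"
  by (simp add: nonzero_component_graph_def)

lemma graph_dist_component_graph:
  assumes "u \<noteq> 0" "v \<noteq> 0"
  shows "graph_dist component_graph u v =
    (if u = v then 0 else if supp u \<inter> supp v \<noteq> {} then 1 else 2)"
proof -
  let ?G = "nonzero_component_graph Basis"
  have arc: "(x, y) \<in> parcs ?G \<longleftrightarrow> x \<noteq> y \<and> supp x \<inter> supp y \<noteq> {}" for x y
    by (auto simp: nonzero_component_graph_def supp_def representation_zero)
  \<comment> \<open>The vector with all coefficients 1 is adjacent to every other non-zero vector
    and so serves as the common neighbour.\<close>
  obtain x where x: "supp x = Basis"
    using bij_betw_apply[OF bij_betw_inv_into[OF bij_betw_vectors_with_supp[OF order_refl]],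
        of "restrict (\<lambda>_. 1) Basis"] by auto
  have ne: "supp u \<noteq> {}" "supp v \<noteq> {}" using assms by auto
  have "graph_dist component_graph u v = (if u = v then 0 else if (u, v) \<in> parcs ?G then 1 else 2)"
  proof (rule graph_dist_pair_digraph)
    show "pair_wf_digraph ?G" by unfold_locales (auto simp: nonzero_component_graph_def)
    have "supp x \<noteq> {}" unfolding x using ne(1) supp_subset[of u] by blast
    then show "x \<in> pverts ?G" by simp
    \<comment> \<open>If \<open>u\<close> or \<open>v\<close> were equal to \<open>x\<close>, its
      full support would meet the support of the other one, and \<open>u\<close> and
      \<open>v\<close> would be adjacent.\<close>
    show "(u, x) \<in> parcs ?G \<and> (x, v) \<in> parcs ?G" if "u \<noteq> v" "(u, v) \<notin> parcs ?G"
      using that x ne supp_subset[of u] supp_subset[of v] unfolding arc by blast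
  qed (use assms in \<open>auto simp: nonzero_component_graph_def\<close>)
  then show ?thesis by (simp add: arc)
qed

section \<open>Resolving sets by support classes, and fields with at least three elements\<close>

lemma card_eq_sum_card_supp:
  assumes "finite (UNIV :: 'a set)" "0 \<notin> A"
  shows "card A = (\<Sum>S\<in>Pow Basis - {{}}. card (A \<inter> {v. supp v = S}))"
proof -
  have fin: "finite (C :: 'b set)" for C
    using finite_vectors[OF assms(1)] by (rule rev_finite_subset) simp
  have "A = (\<Union>S\<in>Pow Basis - {{}}. A \<inter> {v. supp v = S})"
    using assms(2) supp_subset by auto
  then have "card A = card (\<Union>S\<in>Pow Basis - {{}}. A \<inter> {v. supp v = S})" by simp
  also have "\<dots> = (\<Sum>S\<in>Pow Basis - {{}}. card (A \<inter> {v. supp v = S}))"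
    by (rule card_UN_disjoint) (use fin finite_Basis in auto)
  finally show ?thesis .
qed

text \<open>A vertex in \<open>W\<close> is recognised by its distance 0 to itself. For a vertex
  outside \<open>W\<close>, the distance to a vector with support \<open>{b}\<close> is 1 or 2
  according to whether \<open>b\<close> lies in its support, so the distances determine the support
  and \<open>inj\<close> determines the vertex.\<close>

lemma resolving_set_component_graphI:
  assumes "finite W" "0 \<notin> W"
    and sing: "\<And>b. b \<in> Basis \<Longrightarrow> \<exists>w\<in>W. supp w = {b}"
    and inj: "inj_on supp ({v. v \<noteq> 0} - W)"
  shows "resolving_set component_graph W"
proof (rule resolving_setI)
  fix u v
  assume "u \<in> verts component_graph" "v \<in> verts component_graph"
  then have nz: "u \<noteq> 0" "v \<noteq> 0" by auto
  assume eq: "\<And>w. w \<in> W \<Longrightarrow> graph_dist component_graph u w = graph_dist component_graph v w"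
  show "u = v"
  proof (cases "u \<in> W \<or> v \<in> W")
    case True
    then show ?thesis
      using eq[of u] eq[of v] nz by (auto simp: graph_dist_component_graph split: if_splits)
  next
    case False
    have "b \<in> supp u \<longleftrightarrow> b \<in> supp v" if b: "b \<in> Basis" for b
    proof -
      obtain w where w: "w \<in> W" "supp w = {b}" using sing b by blast
      moreover have "w \<noteq> 0" "w \<noteq> u" "w \<noteq> v" using w False assms(2) by auto
      ultimately show ?thesis
        using eq[of w] nz by (auto simp: graph_dist_component_graph split: if_splits)
    qed
    then have "supp u = supp v" using supp_subset by blast
    then show ?thesis by (rule inj_onD[OF inj]) (use False nz in auto)
  qed
qed (use assms in auto)

text \<open>The distance to a third vertex depends only on the support, so each support class is a
  set of twins, and the twin bounds add up over the disjoint classes. Over two scalars every term is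
  0, which is why that case is treated by a different count.\<close>

lemma card_le_resolving_set_component_graph:
  assumes "finite (UNIV :: 'a set)" "resolving_set component_graph W"
  shows "(\<Sum>S\<in>Pow Basis - {{}}. (card (UNIV :: 'a set) - 1) ^ card S - 1) \<le> card W"
proof -
  have fin: "finite (C :: 'b set)" for C
    using finite_vectors[OF assms(1)] by (rule rev_finite_subset) simp
  have "(card (UNIV :: 'a set) - 1) ^ card S - 1 \<le> card (W \<inter> {v. supp v = S})"
    if S: "S \<in> Pow Basis - {{}}" for S
  proof -
    have nz: "v \<noteq> 0" if "supp v = S" for v using S that by auto
    have "card {v. supp v = S} - 1 \<le> card (W \<inter> {v. supp v = S})"
      by (rule card_twins_le_of_resolving_set[OF assms(2) fin])
        (simp_all add: subset_iff nz graph_dist_component_graph)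
    then show ?thesis using S by (simp add: card_vectors_with_supp)
  qed
  moreover have "0 \<notin> W" using assms(2) by (auto simp: resolving_set_def)
  ultimately show ?thesis
    by (subst card_eq_sum_card_supp[OF assms(1), of W]) (auto intro!: sum_mono)
qed

lemma metric_dimension_component_graph:
  assumes q: "card (UNIV :: 'a set) \<ge> 3"
  shows "metric_dimension component_graph =
    (\<Sum>S\<in>Pow Basis - {{}}. (card (UNIV :: 'a set) - 1) ^ card S - 1)"
proof -
  have finU: "finite (UNIV :: 'a set)" using q card.infinite by force
  have fin: "finite (C :: 'b set)" for C
    using finite_vectors[OF finU] by (rule rev_finite_subset) simp
  define r where "r S = (SOME v. supp v = S)" for S
  have r: "supp (r S) = S" if "S \<subseteq> Basis" for S
  proof -
    have "card {v. supp v = S} \<noteq> 0" using q by (simp add: card_vectors_with_supp[OF that])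
    then have "\<exists>v. supp v = S" by (metis (mono_tags) card.empty Collect_empty_eq)
    then show ?thesis unfolding r_def by (rule someI_ex)
  qed
  \<comment> \<open>All non-zero vectors except one chosen representative \<open>r S\<close> of each
    support, so that the twin bound is attained in every class.\<close>
  define W where "W = {v. v \<noteq> 0 \<and> v \<noteq> r (supp v)}"
  have "W \<inter> {v. supp v = S} = {v. supp v = S} - {r S}" if "S \<in> Pow Basis - {{}}" for S
    using that by (auto simp: W_def)
  then have cardW: "card (W \<inter> {v. supp v = S}) = (card (UNIV :: 'a set) - 1) ^ card S - 1"
    if "S \<in> Pow Basis - {{}}" for S
    using that by (simp add: r card_vectors_with_supp)
  have W: "resolving_set component_graph W"
  proof (rule resolving_set_component_graphI)
    show "inj_on supp ({v. v \<noteq> 0} - W)" by (auto simp: W_def inj_on_def)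
    show "\<exists>w\<in>W. supp w = {b}" if "b \<in> Basis" for b
    proof -
      \<comment> \<open>The class of a singleton support keeps (q - 1) - 1 vectors, which is
        positive because q is at least 3.\<close>
      have "card (W \<inter> {v. supp v = {b}}) \<noteq> 0" using that q by (subst cardW) auto
      then have "W \<inter> {v. supp v = {b}} \<noteq> {}" by (intro notI) simp
      then show ?thesis by blast
    qed
  qed (simp_all add: fin W_def)
  have "card W = (\<Sum>S\<in>Pow Basis - {{}}. card (W \<inter> {v. supp v = S}))"
    by (rule card_eq_sum_card_supp[OF finU]) (simp add: W_def)
  also have "\<dots> = (\<Sum>S\<in>Pow Basis - {{}}. (card (UNIV :: 'a set) - 1) ^ card S - 1)"
    by (rule sum.cong[OF refl cardW])
  finally show ?thesis
    using metric_dimension_eqI[OF W] card_le_resolving_set_component_graph[OF finU] by simp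
qed

section \<open>The field with two elements\<close>

lemma inj_supp:
  assumes "card (UNIV :: 'a set) = 2"
  shows "inj supp"
proof (rule injI)
  fix u v assume "supp u = supp v"
  then have "u \<in> {w. supp w = supp v}" "v \<in> {w. supp w = supp v}" by auto
  \<comment> \<open>There is a single non-zero scalar, so the support leaves no choice of
    coefficients.\<close>
  moreover have "card {w. supp w = supp v} = 1"
    by (simp add: card_vectors_with_supp supp_subset assms)
  ultimately show "u = v" by (metis card_1_singletonE singletonD)
qed

text \<open>The left side counts the vertices, one for each non-empty support. On the right, the
  vertices outside \<open>W\<close> see only the distances 1 and 2, so they have at most
  \<open>2 ^ card W\<close> representations.\<close>

lemma card_resolving_set_binary_component_graph:
  assumes q: "card (UNIV :: 'a set) = 2" and W: "resolving_set component_graph W"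
  shows "2 ^ dimension - 1 \<le> card W + 2 ^ card W"
proof -
  have finU: "finite (UNIV :: 'a set)" using q card.infinite by force
  have "card {v :: 'b. v \<noteq> 0} = (\<Sum>S\<in>Pow Basis - {{}}. card ({v. v \<noteq> 0} \<inter> {v. supp v = S}))"
    by (rule card_eq_sum_card_supp[OF finU]) simp
  also have "\<dots> = (\<Sum>S\<in>Pow Basis - {{}}. 1)"
  proof (rule sum.cong[OF refl])
    fix S assume S: "S \<in> Pow Basis - {{}}"
    then have "{v. v \<noteq> 0} \<inter> {v. supp v = S} = {v. supp v = S}" by auto
    then show "card ({v. v \<noteq> 0} \<inter> {v. supp v = S}) = 1"
      using S by (simp add: card_vectors_with_supp q)
  qed
  also have "\<dots> = 2 ^ dimension - 1"
    by (simp add: card_Pow finite_Basis dimension_def)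
  finally have "card (verts component_graph) = 2 ^ dimension - 1" by simp
  moreover have "card (verts component_graph) \<le> card W + card {1, 2 :: nat} ^ card W"
    by (rule card_verts_le_of_resolving_set[OF W])
      (use W in \<open>auto simp: resolving_set_def subset_iff graph_dist_component_graph\<close>)
  moreover have "card {1, 2 :: nat} = 2" by simp
  ultimately show ?thesis by metis
qed

lemma metric_dimension_binary_component_graph:
  assumes q: "card (UNIV :: 'a set) = 2" and n: "dimension \<ge> 3"
  shows "metric_dimension component_graph = dimension"
  unfolding dimension_def
proof (rule metric_dimension_eqI)
  show "resolving_set component_graph Basis"
  proof (rule resolving_set_component_graphI)
    show "0 \<notin> Basis" using independent_Basis dependent_zero by blast
    show "inj_on supp ({v. v \<noteq> 0} - Basis)" using inj_supp[OF q] inj_on_subset by blast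
  qed (use finite_Basis supp_basis in auto)
  fix W assume W: "resolving_set component_graph W"
  show "card Basis \<le> card W"
  proof (rule ccontr)
    assume "\<not> ?thesis"
    then have k: "card W \<le> dimension - 1" by (simp add: dimension_def)
    \<comment> \<open>A resolving set with at most n - 1 elements, where n is the dimension, would
      give 2^n - 1 \<le> (n - 1) + 2^(n - 1), that is 2^(n - 1) \<le> n. The inequality with m = n -
      1 refutes this from n = 3 on; for n = 2 it fails, in line with the exceptional value
      1.\<close>
    have "m + 1 < 2 ^ m" if "m \<ge> 2" for m :: nat
      using that by (induction m rule: dec_induct) auto
    from this[of "dimension - 1"] have "dimension < 2 ^ (dimension - 1)" using n by simp
    moreover have "(2 :: nat) ^ dimension = 2 * 2 ^ (dimension - 1)"
      using n by (simp flip: power_Suc)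
    moreover have "(2 :: nat) ^ card W \<le> 2 ^ (dimension - 1)" using k by (intro power_increasing) auto
    ultimately show False
      using card_resolving_set_binary_component_graph[OF q W] k n by linarith
  qed
qed

text \<open>The only vertices are \<open>a\<close>, \<open>b\<close> and \<open>a + b\<close>, whose
  distances to \<open>a\<close> are 0, 2 and 1, so \<open>a\<close> alone resolves the
  graph.\<close>

lemma metric_dimension_binary_plane_component_graph:
  assumes q: "card (UNIV :: 'a set) = 2" and n: "dimension = 2"
  shows "metric_dimension component_graph = 1"
proof -
  obtain a b where ab: "Basis = {a, b}" "a \<noteq> b"
    using n by (auto simp: dimension_def card_2_iff)
  have sa: "supp a = {a}" using supp_basis[of a] ab(1) by blast
  then have a: "a \<noteq> 0" using supp_eq_empty_iff by blast
  have "metric_dimension component_graph = card {a}"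
  proof (rule metric_dimension_eqI)
    show "resolving_set component_graph {a}"
    proof (rule resolving_setI)
      fix u v
      assume "u \<in> verts component_graph" "v \<in> verts component_graph"
      then have nz: "u \<noteq> 0" "v \<noteq> 0" by auto
      assume "\<And>w. w \<in> {a} \<Longrightarrow> graph_dist component_graph u w = graph_dist component_graph v w"
      then have eq: "graph_dist component_graph u a = graph_dist component_graph v a" by simp
      show "u = v"
      proof (cases "u = a \<or> v = a")
        case True
        then show ?thesis
          using eq nz a by (auto simp: graph_dist_component_graph split: if_splits)
      next
        case False
        then have "supp u \<noteq> {a}" "supp v \<noteq> {a}"
          using inj_supp[OF q] sa by (metis injD)+
        moreover have "a \<in> supp u \<longleftrightarrow> a \<in> supp v"
          using False eq nz a by (auto simp: graph_dist_component_graph sa split: if_splits)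
        moreover have "supp u \<noteq> {}" "supp v \<noteq> {}" using nz by auto
        ultimately have "supp u = supp v"
          using supp_subset[of u] supp_subset[of v] unfolding ab by blast
        then show ?thesis using inj_supp[OF q] by (simp add: injD)
      qed
    qed (use a in auto)
    fix W assume "resolving_set component_graph W"
    from card_resolving_set_binary_component_graph[OF q this]
    \<comment> \<open>For \<open>card W = 0\<close> the count would read 3 \<le> 0 + 1.\<close>
    show "card {a} \<le> card W" using n by (cases "card W") auto
  qed
  then show ?thesis by simp
qed

end

section \<open>The three cases in terms of q and n\<close>

theorem theorem2p4:
  fixes scale :: "'f::{field,finite} \<Rightarrow> 'v::ab_group_add \<Rightarrow> 'v"
    and B :: "'v set" and q n :: nat
    and \<Gamma> :: "('v, 'v \<times> 'v) pre_digraph"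
  assumes "finite_dimensional_vector_space scale B"
    and "card (UNIV :: 'f set) = q" and "card B = n" and "n \<ge> 1"
    and "\<Gamma> = with_proj (vector_space.nonzero_component_graph scale B)"
  shows "(q = 2 \<and> n = 2 \<longrightarrow> metric_dimension \<Gamma> = 1) \<and>
    (q = 2 \<and> n \<ge> 3 \<longrightarrow> metric_dimension \<Gamma> = n) \<and>
    (q \<ge> 3 \<longrightarrow> metric_dimension \<Gamma> = (\<Sum>k=1..n. (n choose k) * ((q - 1) ^ k - 1)))"
proof -
  interpret finite_dimensional_vector_space scale B by fact
  have "dimension = n" by (simp add: dimension_def assms(3))
  then show ?thesis
    using metric_dimension_binary_plane_component_graph metric_dimension_binary_component_graph
      metric_dimension_component_graph
      sum_card_nonempty_subsets[OF finite_Basis, of "\<lambda>k. (q - 1) ^ k - 1"]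
    by (simp add: assms)
qed

end
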